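(* Consider the elastic wave equation transformed to curvilinear coordinates $(q,r,s)$, $$\widetilde{\mathbf P}^{-1}\frac{\partial\mathbf Q}{\partial t}=\sum_{\xi=q,r,s}\frac{\partial\mathbf F_\xi(\mathbf Q)}{\partial\xi}+\sum_{\xi=q,r,s}\mathbf B_\xi(\nabla\mathbf Q),$$ with the conservative flux terms $\mathbf F_\xi$ and non-conservative-product terms $\mathbf B_\xi$ given in the context. Then the spatial operators satisfy the anti-symmetric property: for each $\xi\in\{q,r,s\}$, $$\mathbf Q^T\mathbf B_\xi(\nabla\mathbf Q)-\frac{\partial\mathbf Q^T}{\partial\xi}\mathbf F_\xi(\mathbf Q)=0 .$$
   Context: $\mathbf Q=(v_x,v_y,v_z,\sigma_{xx},\sigma_{yy},\sigma_{zz},\sigma_{xy},\sigma_{xz},\sigma_{yz})^T$ is an $\mathbb R^9$-valued (differentiable) function of $(q,r,s,t)$. The reference cube $[0,1]^3\ni(q,r,s)$ is mapped to the physical element with coordinates $(x,y,z)$ by a smooth invertible map with Jacobian determinant $J>0$; $\xi_x,\xi_y,\xi_z$ are the partial derivatives of $\xi\in\{q,r,s\}$ with respect to $x,y,z$. $\widetilde{\mathbf P}=J^{-1}\mathbf P$, where $\mathbf P=\mathrm{diag}(\rho^{-1}I_3,\mathbf C)$ with $\rho>0$ and $\mathbf C$ a symmetric positive definite $6\times 6$ matrix. Here $\nabla=(\partial_q,\partial_r,\partial_s)^T$ and $\mathbf F_\xi(\mathbf Q)=\big(J(\xi_x\sigma_{xx}+\xi_y\sigma_{xy}+\xi_z\sigma_{xz}),\,J(\xi_x\sigma_{xy}+\xi_y\sigma_{yy}+\xi_z\sigma_{yz}),\,J(\xi_x\sigma_{xz}+\xi_y\sigma_{yz}+\xi_z\sigma_{zz}),0,0,0,0,0,0\big)^T$,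 $\mathbf B_\xi(\nabla\mathbf Q)=J\big(0,0,0,\ \xi_x\partial_\xi v_x,\ \xi_y\partial_\xi v_y,\ \xi_z\partial_\xi v_z,\ \xi_y\partial_\xi v_x+\xi_x\partial_\xi v_y,\ \xi_z\partial_\xi v_x+\xi_x\partial_\xi v_z,\ \xi_z\partial_\xi v_y+\xi_y\partial_\xi v_z\big)^T$. *)

theory Defs
  imports "HOL-Analysis.Analysis"
begin

text \<open>
  Index conventions. In \<^typ>\<open>real^3\<close> the indices 1, 2, 3 stand for \<open>q, r, s\<close> on the reference side
  and for \<open>x, y, z\<close> on the physical side. A state
  \<open>Q = (v_x, v_y, v_z, \<sigma>_xx, \<sigma>_yy, \<sigma>_zz, \<sigma>_xy, \<sigma>_xz, \<sigma>_yz)\<close> is a \<^typ>\<open>real^9\<close> with indices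
  1 to 9 in this order (in the index type the numeral 9 equals 0, as usual).
\<close>

definition ref_cube :: "(real^3) set" where
  "ref_cube = {p. \<forall>i. 0 \<le> p $ i \<and> p $ i \<le> 1}"

text \<open>On the faces of the cube the following derivative is one-sided.\<close>

definition ref_partial :: "3 \<Rightarrow> (real^3 \<Rightarrow> 'a::real_normed_vector) \<Rightarrow> real^3 \<Rightarrow> 'a" where
  "ref_partial \<xi> f p =
     vector_derivative (\<lambda>h. f (\<chi> j. if j = \<xi> then h else p $ j)) (at (p $ \<xi>) within {0..1})"

definition ref_gradient :: "(real^3 \<Rightarrow> real^9) \<Rightarrow> real^3 \<Rightarrow> real^9^3" where
  "ref_gradient f p = (\<chi> \<xi>. ref_partial \<xi> f p)"

primrec C_k_on_cube :: "nat \<Rightarrow> (real^3 \<Rightarrow> real^3) \<Rightarrow> bool" where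
  "C_k_on_cube 0 f \<longleftrightarrow> continuous_on ref_cube f"
| "C_k_on_cube (Suc k) f \<longleftrightarrow>
     f differentiable_on ref_cube \<and> (\<forall>\<xi>. C_k_on_cube k (ref_partial \<xi> f))"

definition smooth_on_cube :: "(real^3 \<Rightarrow> real^3) \<Rightarrow> bool" where
  "smooth_on_cube f \<longleftrightarrow> (\<forall>k. C_k_on_cube k f)"

definition jac_det :: "(real^3 \<Rightarrow> real^3) \<Rightarrow> real^3 \<Rightarrow> real" where
  "jac_det \<Phi> p = det (jacobian \<Phi> (at p within ref_cube))"

text \<open>
  The physical element is \<open>\<Phi> ` ref_cube\<close>. Smoothness of the inverse map is not demanded: it
  follows from the other conditions by the inverse function theorem.
\<close>

definition element_map :: "(real^3 \<Rightarrow> real^3) \<Rightarrow> bool" where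
  "element_map \<Phi> \<longleftrightarrow>
     smooth_on_cube \<Phi> \<and> inj_on \<Phi> ref_cube \<and> (\<forall>p\<in>ref_cube. 0 < jac_det \<Phi> p)"

text \<open>
  The entry \<open>metric \<Phi> p $ \<xi> $ j\<close> is the partial derivative of the reference coordinate \<open>\<xi>\<close>, as a
  function on the physical element, with respect to the \<open>j\<close>-th physical coordinate, taken at the
  physical point \<open>\<Phi> p\<close>; so row \<open>\<xi>\<close> is \<open>(\<xi>_x, \<xi>_y, \<xi>_z)\<close>.
\<close>

definition metric :: "(real^3 \<Rightarrow> real^3) \<Rightarrow> real^3 \<Rightarrow> real^3^3" where
  "metric \<Phi> p = jacobian (the_inv_into ref_cube \<Phi>) (at (\<Phi> p) within \<Phi> ` ref_cube)"

definition flux :: "(real^3 \<Rightarrow> real^3) \<Rightarrow> 3 \<Rightarrow> real^3 \<Rightarrow> real^9 \<Rightarrow> real^9" where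
  "flux \<Phi> \<xi> p u =
     (let J = jac_det \<Phi> p;
          \<xi>\<^sub>x = metric \<Phi> p $ \<xi> $ 1; \<xi>\<^sub>y = metric \<Phi> p $ \<xi> $ 2; \<xi>\<^sub>z = metric \<Phi> p $ \<xi> $ 3;
          \<sigma>xx = u $ 4; \<sigma>yy = u $ 5; \<sigma>zz = u $ 6; \<sigma>xy = u $ 7; \<sigma>xz = u $ 8; \<sigma>yz = u $ 9
      in vector [J * (\<xi>\<^sub>x * \<sigma>xx + \<xi>\<^sub>y * \<sigma>xy + \<xi>\<^sub>z * \<sigma>xz),
                 J * (\<xi>\<^sub>x * \<sigma>xy + \<xi>\<^sub>y * \<sigma>yy + \<xi>\<^sub>z * \<sigma>yz),
                 J * (\<xi>\<^sub>x * \<sigma>xz + \<xi>\<^sub>y * \<sigma>yz + \<xi>\<^sub>z * \<sigma>zz),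
                 0, 0, 0, 0, 0, 0])"

text \<open>The last argument is the gradient of the state; only its row \<open>\<xi>\<close> enters.\<close>

definition ncp :: "(real^3 \<Rightarrow> real^3) \<Rightarrow> 3 \<Rightarrow> real^3 \<Rightarrow> real^9^3 \<Rightarrow> real^9" where
  "ncp \<Phi> \<xi> p G =
     (let J = jac_det \<Phi> p;
          \<xi>\<^sub>x = metric \<Phi> p $ \<xi> $ 1; \<xi>\<^sub>y = metric \<Phi> p $ \<xi> $ 2; \<xi>\<^sub>z = metric \<Phi> p $ \<xi> $ 3;
          dvx = G $ \<xi> $ 1; dvy = G $ \<xi> $ 2; dvz = G $ \<xi> $ 3
      in J *\<^sub>R vector [0, 0, 0,
                      \<xi>\<^sub>x * dvx,
                      \<xi>\<^sub>y * dvy,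
                      \<xi>\<^sub>z * dvz,
                      \<xi>\<^sub>y * dvx + \<xi>\<^sub>x * dvy,
                      \<xi>\<^sub>z * dvx + \<xi>\<^sub>x * dvz,
                      \<xi>\<^sub>z * dvy + \<xi>\<^sub>y * dvz])"

text \<open>
  The block matrix \<open>P = diag(1/\<rho> I, C)\<close>, and the transformed elastic wave equation whose spatial
  operators are \<^const>\<open>flux\<close> and \<^const>\<open>ncp\<close>. The coefficients, density \<open>\<rho> > 0\<close> and symmetric
  positive definite \<open>C\<close>, may vary in space; they do not enter the spatial operators.
\<close>

definition material_matrix :: "real \<Rightarrow> real^6^6 \<Rightarrow> real^9^9" where
  "material_matrix \<rho> C = matrix (\<lambda>u.
     let w = C *v vector [u $ 4, u $ 5, u $ 6, u $ 7, u $ 8, u $ 9]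
     in vector [u $ 1 / \<rho>, u $ 2 / \<rho>, u $ 3 / \<rho>, w $ 1, w $ 2, w $ 3, w $ 4, w $ 5, w $ 6])"

definition solves_elastic_wave ::
  "(real^3 \<Rightarrow> real^3) \<Rightarrow> (real^3 \<Rightarrow> real) \<Rightarrow> (real^3 \<Rightarrow> real^6^6) \<Rightarrow> real set
     \<Rightarrow> (real^3 \<Rightarrow> real \<Rightarrow> real^9) \<Rightarrow> bool" where
  "solves_elastic_wave \<Phi> \<rho> C T Q \<longleftrightarrow>
     (\<forall>p\<in>ref_cube. \<forall>t\<in>T.
        matrix_inv (inverse (jac_det \<Phi> p) *\<^sub>R material_matrix (\<rho> p) (C p))
          *v vector_derivative (Q p) (at t within T)
        = (\<Sum>\<xi>\<in>UNIV. ref_partial \<xi> (\<lambda>p'. flux \<Phi> \<xi> p' (Q p' t)) p)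
          + (\<Sum>\<xi>\<in>UNIV. ncp \<Phi> \<xi> p (ref_gradient (\<lambda>p'. Q p' t) p)))"

end

theory Submission
  imports Defs
begin

text \<open>Pointwise, both products are the same contraction. The stress entries of
  \<open>Q\<close> meet the non-conservative term, and the velocity entries of the derivative meet
  the flux. With a symmetric stress \<sigma>, each gives J times the sum over i, j of \<xi>_i
  \<sigma>_ij (d_\<xi> v_j); an off-diagonal stress, stored once, collects both of its index orders.
  \<open>inner_ncp_eq_inner_flux\<close> is this identity.\<close>

lemma exhaust_9: "x = 1 \<or> x = 2 \<or> x = 3 \<or> x = 4 \<or> x = 5 \<or> x = 6 \<or> x = 7 \<or> x = 8 \<or> x = 9"
  for x :: 9
proof (induct x)
  case (of_int z)
  then have "0 \<le> z" "z < 9"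
    by simp_all
  \<comment> \<open>The residue 0 is the numeral 9 of the index type, so \<open>z = 0\<close> yields
    the last alternative.\<close>
  then have "z = 0 \<or> z = 1 \<or> z = 2 \<or> z = 3 \<or> z = 4 \<or> z = 5 \<or> z = 6 \<or> z = 7 \<or> z = 8"
    by arith
  then show ?case
    by auto
qed

lemma UNIV_9: "UNIV = {1, 2, 3, 4, 5, 6, 7, 8, 9 :: 9}"
  using exhaust_9 by auto

lemma sum_9: "sum f (UNIV :: 9 set) = f 1 + f 2 + f 3 + f 4 + f 5 + f 6 + f 7 + f 8 + f 9"
  unfolding UNIV_9 by (simp add: ac_simps)

lemma vector_9:
  fixes a :: "'a::zero"
  shows "(vector [a, b, c, d, e, f, g, h, k] :: 'a^9) $ 1 = a"
    and "(vector [a, b, c, d, e, f, g, h, k] :: 'a^9) $ 2 = b"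
    and "(vector [a, b, c, d, e, f, g, h, k] :: 'a^9) $ 3 = c"
    and "(vector [a, b, c, d, e, f, g, h, k] :: 'a^9) $ 4 = d"
    and "(vector [a, b, c, d, e, f, g, h, k] :: 'a^9) $ 5 = e"
    and "(vector [a, b, c, d, e, f, g, h, k] :: 'a^9) $ 6 = f"
    and "(vector [a, b, c, d, e, f, g, h, k] :: 'a^9) $ 7 = g"
    and "(vector [a, b, c, d, e, f, g, h, k] :: 'a^9) $ 8 = h"
    and "(vector [a, b, c, d, e, f, g, h, k] :: 'a^9) $ 9 = k"
  unfolding vector_def by simp_all

text \<open>With the state \<open>u\<close> and the gradient \<open>G\<close> as independent
  variables, this is a polynomial identity in their entries, the metric entries and the Jacobian
  determinant.\<close>

lemma inner_ncp_eq_inner_flux: "u \<bullet> ncp \<Phi> \<xi> p G = G $ \<xi> \<bullet> flux \<Phi> \<xi> p u"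
  by (simp add: ncp_def flux_def Let_def inner_vec_def sum_9 vector_9) (simp add: algebra_simps)

theorem lemma2:
  fixes \<Phi> :: "real^3 \<Rightarrow> real^3" and T :: "real set" and Q :: "real^3 \<Rightarrow> real \<Rightarrow> real^9"
  assumes "element_map \<Phi>"
    and "(\<lambda>(p, t). Q p t) differentiable_on (ref_cube \<times> T)"
  shows "\<forall>\<xi>. \<forall>p\<in>ref_cube. \<forall>t\<in>T.
           Q p t \<bullet> ncp \<Phi> \<xi> p (ref_gradient (\<lambda>p'. Q p' t) p)
             - ref_partial \<xi> (\<lambda>p'. Q p' t) p \<bullet> flux \<Phi> \<xi> p (Q p t) = 0"
  \<comment> \<open>Row \<open>\<xi>\<close> of \<open>ref_gradient\<close> is
    \<open>ref_partial \<xi>\<close>, so the two terms coincide.\<close>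
  by (simp add: inner_ncp_eq_inner_flux ref_gradient_def)

end
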